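(* Let $\mathcal A$ be a central arrangement of hyperplanes in $\mathbb C^\ell$ with underlying matroid $G=G(\mathcal A)$, let $X\in L(\mathcal A)$, and let $\pi:\mathbb C^\ell\to\mathbb C^\ell/X$ be the natural projection. Let $\mathcal A_\pi$ be the affine arrangement obtained by restricting $\mathcal A$ to a generic fiber of $\pi$. Then the matroid $G(c\mathcal A_\pi)$ of the cone of $\mathcal A_\pi$ is isomorphic to the complete principal truncation $\bar T_X(G)$ of $G$ along the flat $\mathcal A_X$.
   Context: A central arrangement $\mathcal A$ in $\mathbb C^\ell$ is a finite set of linear hyperplanes. Its underlying matroid $G(\mathcal A)$ has ground set $\mathcal A$, a set $\mathcal B\subseteq\mathcal A$ being dependent iff $\operatorname{codim}(\bigcap\mathcal B)<|\mathcal B|$. The intersection lattice $L(\mathcal A)$ is the set of intersections of subsets of $\mathcal A$, ordered by reverse inclusion, with rank function $r(X)=\operatorname{codim}X$; $X\in L(\mathcal A)$ is identified with the flat $\mathcal A_X=\{H\in\mathcal A: H\supseteq X\}$ of $G(\mathcal A)$. The restriction of $\mathcal A$ to an affine subspace $S$ is the arrangement in $S$ of the nonempty proper intersections $H\cap S$, $H\in\mathcal A$. The cone $c\mathcal B$ of an affine arrangement $\mathcal B$ in $\mathbb C^{m}$ is the central arrangement in $\mathbb C^{m+1}$ obtained by placing $\mathcal B$ in $\{1\}\times\mathbb C^m$, replacing each affine hyperplane by its linear span, and adjoining the hyperplane $\{0\}\times\mathbb C^m$. The principal truncation $T_F(G)$ of a matroid $G$ along a flat $F$ is obtained by adding a generic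 point on $F$ and contracting on it; the complete principal truncation $\bar T_F(G)$ is the result of $r(F)-1$ successive principal truncations along $F$ (equivalently, adding $r(F)-1$ generic points to $F$ and contracting on the flat they span). Matroids are tacitly simplified (multiple points removed). *)

theory Defs
  imports "HOL-Analysis.Analysis"
begin

section \<open>Matroids\<close>

text \<open>
  A matroid is given by its ground set and its independent sets.  All matroids considered here are
  finite; the constructions below make sense for any such pair, so the matroid axioms are not built
  into the type.
\<close>

datatype 'a matroid = Matroid (ground: "'a set") (indep: "'a set \<Rightarrow> bool")

definition matroid_rank :: "'a matroid \<Rightarrow> 'a set \<Rightarrow> nat" where
  "matroid_rank M S = Max (card ` {I. I \<subseteq> S \<and> indep M I})"

definition matroid_closure :: "'a matroid \<Rightarrow> 'a set \<Rightarrow> 'a set" where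
  "matroid_closure M S = {x \<in> ground M. matroid_rank M (insert x S) = matroid_rank M S}"

definition contraction :: "'a matroid \<Rightarrow> 'a set \<Rightarrow> 'a matroid" where
  "contraction M T =
     Matroid (ground M - T)
       (\<lambda>I. I \<subseteq> ground M - T \<and> matroid_rank M (I \<union> T) = card I + matroid_rank M T)"

definition relabel :: "('a \<Rightarrow> 'b) \<Rightarrow> 'b matroid \<Rightarrow> 'a matroid" where
  "relabel f M = Matroid (f -` ground M) (\<lambda>I. indep M (f ` I))"

text \<open>
  Adding a generic point on the flat \<open>F\<close>: the new point \<open>None\<close> lies in the closure of a set \<open>S\<close> of
  old points exactly when \<open>F\<close> does.
\<close>

definition principal_extension :: "'a matroid \<Rightarrow> 'a set \<Rightarrow> 'a option matroid" where
  "principal_extension M F =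
     Matroid (insert None (Some ` ground M))
       (\<lambda>J. J \<subseteq> insert None (Some ` ground M) \<and> indep M (Some -` J) \<and>
            (None \<in> J \<longrightarrow> \<not> F \<subseteq> matroid_closure M (Some -` J)))"

definition principal_truncation :: "'a set \<Rightarrow> 'a matroid \<Rightarrow> 'a matroid" where
  "principal_truncation F M = relabel Some (contraction (principal_extension M F) {None})"

text \<open>
  Meaningful only for flats of rank at least one.  The set \<open>F\<close> remains a flat at each step, its rank
  dropping by one.
\<close>

definition complete_principal_truncation :: "'a set \<Rightarrow> 'a matroid \<Rightarrow> 'a matroid" where
  "complete_principal_truncation F M = (principal_truncation F ^^ (matroid_rank M F - 1)) M"

definition parallel_class :: "'a matroid \<Rightarrow> 'a \<Rightarrow> 'a set" where
  "parallel_class M x = {y \<in> ground M. indep M {y} \<and> matroid_rank M {x, y} = 1}"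

text \<open>
  The points of the simplification are the parallel classes of non-loops, so that no choice of
  representatives is needed.
\<close>

definition simplification :: "'a matroid \<Rightarrow> 'a set matroid" where
  "simplification M =
     (let E = parallel_class M ` {x \<in> ground M. indep M {x}}
      in Matroid E (\<lambda>C. C \<subseteq> E \<and> matroid_rank M (\<Union>C) = card C))"

definition matroid_isomorphic :: "'a matroid \<Rightarrow> 'b matroid \<Rightarrow> bool" where
  "matroid_isomorphic M N \<longleftrightarrow>
     (\<exists>f. bij_betw f (ground M) (ground N) \<and>
          (\<forall>I \<subseteq> ground M. indep M I \<longleftrightarrow> indep N (f ` I)))"


section \<open>Arrangements\<close>

text \<open>
  Linear algebra is over the complex numbers: \<open>vec.subspace\<close>, \<open>vec.span\<close> and \<open>vec.dim\<close> refer to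
  scalar multiplication by complex numbers.  An arrangement lives in an ambient subspace \<open>W\<close>, which
  is \<open>UNIV\<close> for an arrangement in the full coordinate space.
\<close>

definition codim :: "(complex^'n) set \<Rightarrow> (complex^'n) set \<Rightarrow> nat" where
  "codim W Y = vec.dim W - vec.dim Y"

definition central_arrangement :: "(complex^'n) set \<Rightarrow> (complex^'n) set set \<Rightarrow> bool" where
  "central_arrangement W A \<longleftrightarrow>
     finite A \<and> (\<forall>H\<in>A. vec.subspace H \<and> H \<subseteq> W \<and> codim W H = 1)"

definition arrangement_matroid ::
    "(complex^'n) set \<Rightarrow> (complex^'n) set set \<Rightarrow> (complex^'n) set matroid" where
  "arrangement_matroid W A =
     Matroid A (\<lambda>B. B \<subseteq> A \<and> \<not> codim W (W \<inter> \<Inter>B) < card B)"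

definition intersection_lattice ::
    "(complex^'n) set \<Rightarrow> (complex^'n) set set \<Rightarrow> (complex^'n) set set" where
  "intersection_lattice W A = {W \<inter> \<Inter>B | B. B \<subseteq> A}"

definition flat_of :: "(complex^'n) set set \<Rightarrow> (complex^'n) set \<Rightarrow> (complex^'n) set set" where
  "flat_of A X = {H \<in> A. X \<subseteq> H}"

definition restriction ::
    "(complex^'n) set set \<Rightarrow> (complex^'n) set \<Rightarrow> (complex^'n) set set" where
  "restriction A S = {H \<inter> S | H. H \<in> A \<and> H \<inter> S \<noteq> {} \<and> H \<inter> S \<noteq> S}"

text \<open>
  The cone of an arrangement \<open>B\<close> in an affine subspace \<open>S\<close> of dimension \<open>m\<close>.  Instead of choosing
  coordinates on \<open>S\<close>, we place \<open>S\<close> itself at height one; an affine isomorphism between \<open>S\<close> and the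
  \<open>m\<close>-dimensional coordinate space extends uniquely to a linear one between \<open>cone_space S\<close> and the
  \<open>(m+1)\<close>-dimensional coordinate space, matching the part of \<open>cone_space S\<close> at height zero with the
  hyperplane at infinity.  The coordinate \<open>None\<close> is the height.
\<close>

definition at_height :: "complex \<Rightarrow> complex^'n \<Rightarrow> complex^('n option)" where
  "at_height t v = (\<chi> i. case i of None \<Rightarrow> t | Some j \<Rightarrow> v $ j)"

definition direction :: "(complex^'n) set \<Rightarrow> (complex^'n) set" where
  "direction S = {u - v | u v. u \<in> S \<and> v \<in> S}"

definition cone_space :: "(complex^'n) set \<Rightarrow> (complex^('n option)) set" where
  "cone_space S = vec.span (at_height 1 ` S)"

definition arrangement_cone ::
    "(complex^'n) set \<Rightarrow> (complex^'n) set set \<Rightarrow> (complex^('n option)) set set" where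
  "arrangement_cone S B =
     insert (at_height 0 ` direction S) ((\<lambda>K. vec.span (at_height 1 ` K)) ` B)"


section \<open>Generic fibers\<close>

inductive complex_polynomial_function :: "(complex^'n \<Rightarrow> complex) \<Rightarrow> bool" where
  const: "complex_polynomial_function (\<lambda>v. c)"
| coord: "complex_polynomial_function (\<lambda>v. v $ i)"
| add: "complex_polynomial_function p \<Longrightarrow> complex_polynomial_function q \<Longrightarrow>
    complex_polynomial_function (\<lambda>v. p v + q v)"
| mult: "complex_polynomial_function p \<Longrightarrow> complex_polynomial_function q \<Longrightarrow>
    complex_polynomial_function (\<lambda>v. p v * q v)"

definition zariski_open :: "(complex^'n) set \<Rightarrow> bool" where
  "zariski_open U \<longleftrightarrow>
     (\<exists>P. (\<forall>p\<in>P. complex_polynomial_function p) \<and> - U = {v. \<forall>p\<in>P. p v = 0})"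

definition quotient_map :: "(complex^'n) set \<Rightarrow> complex^'n \<Rightarrow> (complex^'n) set" where
  "quotient_map X v = (\<lambda>x. v + x) ` X"

text \<open>
  A property holds for a generic fiber of the projection along \<open>X\<close> if it holds for the fibers over
  all points of some nonempty Zariski open subset \<open>U\<close> of the quotient space.  The Zariski topology of
  the quotient space is the quotient topology.
\<close>

definition for_generic_fiber :: "(complex^'n) set \<Rightarrow> ((complex^'n) set \<Rightarrow> bool) \<Rightarrow> bool" where
  "for_generic_fiber X \<Phi> \<longleftrightarrow>
     (\<exists>U. U \<subseteq> range (quotient_map X) \<and> U \<noteq> {} \<and> zariski_open (quotient_map X -` U) \<and>
          (\<forall>p\<in>U. \<Phi> (quotient_map X -` {p})))"

end

theory Submission
  imports Defs
begin

text \<open>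
  A fiber over a point outside \<open>X\<close> is \<open>S = v + X\<close>.  Forgetting the height maps \<open>cone_space S\<close>
  isomorphically onto \<open>Y = span (insert v X)\<close>; the cone over \<open>H \<inter> S\<close> becomes \<open>H \<inter> Y\<close>, and the
  hyperplane at infinity becomes \<open>X\<close>, which is \<open>H \<inter> Y\<close> for every \<open>H\<close> containing \<open>X\<close>.  So the matroid
  of the cone is the simplification of the matroid of the sections \<open>H \<inter> Y\<close>.  For a flat \<open>Z\<close>, a
  generic \<open>v\<close> avoids \<open>Z + X\<close> unless this is the whole space, and then the codimension of \<open>Z \<inter> Y\<close> in
  \<open>Y\<close> is the minimum of \<open>codim Z\<close> and \<open>codim (Z \<inter> X) - (codim X - 1)\<close>.  This is exactly the rank
  function of the complete principal truncation.
\<close>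

section \<open>Principal truncations of independence systems\<close>

text \<open>Collects what the truncation formula consumes, in a form that can be checked for every
  intermediate truncation from its explicit description.\<close>

locale finite_independence_system =
  fixes M :: "'a matroid"
  assumes finite_ground: "finite (ground M)"
    and indep_subset_ground: "indep M I \<Longrightarrow> I \<subseteq> ground M"
    and indep_empty: "indep M {}"
    and indep_mono: "indep M J \<Longrightarrow> I \<subseteq> J \<Longrightarrow> indep M I"
begin

lemma finite_ranks: "finite (card ` {I. I \<subseteq> S \<and> indep M I})"
proof -
  have "{I. I \<subseteq> S \<and> indep M I} \<subseteq> Pow (ground M)"
    using indep_subset_ground by auto
  then show ?thesis
    using finite_ground by (meson finite_Pow_iff finite_imageI finite_subset)
qed

lemma card_le_matroid_rank: "I \<subseteq> S \<Longrightarrow> indep M I \<Longrightarrow> card I \<le> matroid_rank M S"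
  unfolding matroid_rank_def by (rule Max_ge[OF finite_ranks]) blast

lemma obtain_basis:
  obtains I where "I \<subseteq> S" "indep M I" "card I = matroid_rank M S"
proof -
  have "matroid_rank M S \<in> card ` {I. I \<subseteq> S \<and> indep M I}"
    unfolding matroid_rank_def using indep_empty by (intro Max_in[OF finite_ranks]) auto
  then show ?thesis
    using that by auto
qed

text \<open>An independent subset of \<open>S\<close> with \<open>card S\<close> elements is
  \<open>S\<close> itself. This turns the rank condition in a contraction into independence.\<close>

lemma matroid_rank_eq_card_iff:
  assumes "finite S"
  shows "matroid_rank M S = card S \<longleftrightarrow> indep M S"
  by (metis assms card_le_matroid_rank card_mono card_subset_eq dual_order.antisym obtain_basis order_refl)

text \<open>For \<open>x\<close> outside \<open>I\<close> the rank of \<open>insert x I\<close> is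
  \<open>card I\<close> or one more, and the larger value can only be attained by
  \<open>insert x I\<close> itself.\<close>

lemma subset_matroid_closure_iff:
  assumes "F \<subseteq> ground M" and I: "indep M I"
  shows "F \<subseteq> matroid_closure M I \<longleftrightarrow> (\<forall>x\<in>F - I. \<not> indep M (insert x I))"
proof -
  have fin: "finite I"
    using I finite_ground finite_subset indep_subset_ground by blast
  have rank_I: "matroid_rank M I = card I"
    using I fin matroid_rank_eq_card_iff by blast
  have "matroid_rank M (insert x I) = matroid_rank M I \<longleftrightarrow> x \<in> I \<or> \<not> indep M (insert x I)" for x
  proof (cases "x \<in> I")
    case False
    obtain J where J: "J \<subseteq> insert x I" "indep M J" "card J = matroid_rank M (insert x I)"
      using obtain_basis .
    have "card J \<le> Suc (card I)"
      using J(1) fin by (metis False card_insert_disjoint card_mono finite_insert)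
    moreover have "card J \<noteq> Suc (card I)" if "\<not> indep M (insert x I)"
      using that J fin False by (metis card_insert_disjoint card_subset_eq finite_insert)
    moreover have "card I \<le> card J"
      using card_le_matroid_rank[of I "insert x I"] I J by auto
    moreover have "matroid_rank M (insert x I) = Suc (card I)" if "indep M (insert x I)"
      using that fin False matroid_rank_eq_card_iff[of "insert x I"] by simp
    ultimately show ?thesis
      using False rank_I J(3) by force
  qed (simp add: insert_absorb)
  then show ?thesis
    using assms(1) unfolding matroid_closure_def by auto
qed

text \<open>The new point has rank one, so contracting it leaves the sets that stay independent
  together with \<open>None\<close>. By the closure criterion these are the independent sets that
  some point of \<open>F\<close> extends.\<close>

lemma principal_truncation_eq:
  assumes F: "F \<subseteq> ground M" and nonloop: "x \<in> F" "indep M {x}"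
  shows "principal_truncation F M =
    Matroid (ground M) (\<lambda>I. indep M I \<and> (\<exists>x\<in>F - I. indep M (insert x I)))"
proof -
  let ?P = "principal_extension M F"
  have vimage_Some: "Some -` (Some ` I) = I" "Some -` insert None (Some ` I) = I" for I :: "'a set"
    by auto
  have indep_P: "indep ?P J \<longleftrightarrow> J \<subseteq> insert None (Some ` ground M) \<and> indep M (Some -` J) \<and>
      (None \<in> J \<longrightarrow> (\<exists>x\<in>F - Some -` J. indep M (insert x (Some -` J))))" for J
    using subset_matroid_closure_iff[OF F, of "Some -` J"]
    unfolding principal_extension_def matroid.sel by blast
  interpret P: finite_independence_system ?P
  proof
    show "finite (ground ?P)"
      using finite_ground by (simp add: principal_extension_def)
    show "I \<subseteq> ground ?P" if "indep ?P I" for I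
      using that by (simp add: principal_extension_def)
    show "indep ?P {}"
      by (simp add: indep_P indep_empty)
    show "indep ?P I" if "indep ?P J" "I \<subseteq> J" for I J
    proof -
      \<comment> \<open>A point of \<open>F\<close> that witnesses the condition for
        \<open>J\<close> lies outside \<open>I\<close> as well and, by downward closure, witnesses
        it for \<open>I\<close>.\<close>
      have "Some -` I \<subseteq> Some -` J"
        using that by blast
      then show ?thesis
        using that unfolding indep_P
        by (meson DiffD1 DiffD2 DiffI indep_mono insert_mono subset_iff)
    qed
  qed
  \<comment> \<open>A nonloop in \<open>F\<close> keeps \<open>F\<close> out of the closure of the
    empty set, so \<open>None\<close> is not a loop.\<close>
  have rank_None: "matroid_rank ?P {None} = 1"
  proof -
    have "Some -` {None} = ({} :: 'a set)"
      by auto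
    then have "indep ?P {None}"
      using nonloop by (auto simp: indep_P indep_empty)
    then show ?thesis
      using P.matroid_rank_eq_card_iff[of "{None}"] by simp
  qed
  have "indep (principal_truncation F M) I \<longleftrightarrow>
      indep M I \<and> (\<exists>x\<in>F - I. indep M (insert x I))" for I
  proof (cases "I \<subseteq> ground M")
    case True
    then have fin: "finite I"
      using finite_ground finite_subset by blast
    then have "card (insert None (Some ` I)) = card I + 1"
      by (simp add: card_image card_insert_if)
    then have "indep (principal_truncation F M) I \<longleftrightarrow>
        matroid_rank ?P (insert None (Some ` I)) = card (insert None (Some ` I))"
      using True rank_None
      by (auto simp: principal_truncation_def relabel_def contraction_def principal_extension_def card_image)
    also have "\<dots> \<longleftrightarrow> indep ?P (insert None (Some ` I))"
      using fin by (intro P.matroid_rank_eq_card_iff) simp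
    also have "\<dots> \<longleftrightarrow> indep M I \<and> (\<exists>x\<in>F - I. indep M (insert x I))"
      using True unfolding indep_P vimage_Some by auto
    finally show ?thesis .
  next
    case False
    then show ?thesis
      using indep_subset_ground
      by (auto simp: principal_truncation_def relabel_def contraction_def principal_extension_def)
  qed
  moreover have "ground (principal_truncation F M) = ground M"
    by (auto simp: principal_truncation_def relabel_def contraction_def principal_extension_def)
  ultimately show ?thesis
    by (intro matroid.expand) (simp add: fun_eq_iff)
qed

end

section \<open>Ranks in hyperplane arrangements\<close>

lemma subspace_Inter:
  fixes A :: "(complex^'n) set set"
  assumes "\<And>H. H \<in> A \<Longrightarrow> vec.subspace H"
  shows "vec.subspace (\<Inter>A)"
  using assms by (auto simp: vec.subspace_def)

lemma sums_eq_span_Un: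
  fixes Z W :: "(complex^'n) set"
  assumes "vec.subspace Z" "vec.subspace W"
  shows "{x + y |x y. x \<in> Z \<and> y \<in> W} = vec.span (Z \<union> W)"
  using assms unfolding vec.span_Un by (simp add: vec.span_eq_iff[THEN iffD2])

lemma dim_span_Un_Int:
  fixes Z W :: "(complex^'n) set"
  assumes "vec.subspace Z" "vec.subspace W"
  shows "vec.dim (vec.span (Z \<union> W)) + vec.dim (Z \<inter> W) = vec.dim Z + vec.dim W"
  using vec.dim_sums_Int[OF assms] unfolding sums_eq_span_Un[OF assms] .

lemma dim_less:
  fixes Z W :: "(complex^'n) set"
  assumes "vec.subspace Z" "vec.subspace W" "Z \<subset> W"
  shows "vec.dim Z < vec.dim W"
  using assms vec.subspace_dim_equal[of Z W] by (fastforce simp flip: not_le)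

lemma codim_mono:
  fixes W :: "(complex^'n) set"
  shows "Z \<subseteq> Y \<Longrightarrow> codim W Y \<le> codim W Z"
  unfolding codim_def by (simp add: diff_le_mono2 vec.dim_subset)

text \<open>The sum of \<open>Z\<close> and \<open>H\<close> has dimension at most one more than
  \<open>H\<close>; the dimension formula does the rest.\<close>

lemma dim_le_Suc_dim_Int_hyperplane:
  fixes H Z :: "(complex^'n) set"
  assumes H: "vec.subspace H" "codim UNIV H = 1" and Z: "vec.subspace Z"
  shows "vec.dim Z \<le> Suc (vec.dim (Z \<inter> H))"
proof -
  have "vec.dim (vec.span (Z \<union> H)) \<le> vec.dim (UNIV :: (complex^'n) set)"
    by (rule vec.dim_subset) simp
  then show ?thesis
    using dim_span_Un_Int[OF Z H(1)] H(2) unfolding codim_def by linarith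
qed

lemma subset_hyperplaneD:
  fixes H W :: "(complex^'n) set"
  assumes H: "vec.subspace H" "codim UNIV H = 1" and W: "vec.subspace W" "H \<subseteq> W"
  shows "W = H \<or> W = UNIV"
proof (rule ccontr)
  assume "\<not> ?thesis"
  then have "vec.dim H < vec.dim W" "vec.dim W < vec.dim (UNIV :: (complex^'n) set)"
    using dim_less[of H W] dim_less[of W UNIV] assms by auto
  then show False
    using H(2) unfolding codim_def by linarith
qed

section \<open>Codimension as the rank function of an arrangement\<close>

locale hyperplanes =
  fixes A :: "(complex^'n) set set"
  assumes finite_A: "finite A"
    and hyperplane: "H \<in> A \<Longrightarrow> vec.subspace H" "H \<in> A \<Longrightarrow> codim UNIV H = 1"
begin

lemma subspace_flat: "S \<subseteq> A \<Longrightarrow> vec.subspace (\<Inter>S)"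
  using subspace_Inter hyperplane(1) by blast

text \<open>Greedy choice: running through \<open>S\<close>, a hyperplane is kept only if it cuts
  the current intersection properly, and then the dimension drops by exactly one. The ambient
  \<open>Y\<close> is arbitrary because flats serve as ambient spaces below.\<close>

lemma obtain_codim_basis:
  assumes Y: "vec.subspace Y" and "S \<subseteq> A"
  obtains I where "I \<subseteq> S" "Y \<inter> \<Inter>I = Y \<inter> \<Inter>S" "card I = codim Y (Y \<inter> \<Inter>S)"
proof -
  have "finite S"
    using assms finite_A finite_subset by blast
  then have "\<exists>I\<subseteq>S. Y \<inter> \<Inter>I = Y \<inter> \<Inter>S \<and> card I = codim Y (Y \<inter> \<Inter>S)"
    using \<open>S \<subseteq> A\<close>
  proof (induction S rule: finite_induct)
    case empty
    then show ?case
      by (simp add: codim_def)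
  next
    case (insert H S)
    then obtain I where I: "I \<subseteq> S" "Y \<inter> \<Inter>I = Y \<inter> \<Inter>S" "card I = codim Y (Y \<inter> \<Inter>S)"
      by auto
    let ?Z = "Y \<inter> \<Inter>S"
    have insert_eq: "Y \<inter> \<Inter>(insert H S) = ?Z \<inter> H"
      by auto
    show ?case
    proof (cases "?Z \<subseteq> H")
      case True
      then have "Y \<inter> \<Inter>(insert H S) = ?Z"
        by auto
      then show ?thesis
        using I by (intro exI[of _ I]) auto
    next
      case False
      have sub: "vec.subspace ?Z" "vec.subspace H"
        using Y subspace_flat[of S] hyperplane insert.prems by (auto intro: vec.subspace_inter)
      then have "vec.dim (?Z \<inter> H) < vec.dim ?Z"
        using False by (intro dim_less) (auto intro: vec.subspace_inter)
      moreover have "vec.dim ?Z \<le> Suc (vec.dim (?Z \<inter> H))"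
        using dim_le_Suc_dim_Int_hyperplane hyperplane insert.prems sub by auto
      moreover have "vec.dim ?Z \<le> vec.dim Y"
        by (intro vec.dim_subset) auto
      moreover have "H \<notin> I" "finite I"
        using I(1) insert.hyps finite_subset by blast+
      ultimately have "card (insert H I) = codim Y (Y \<inter> \<Inter>(insert H S))"
        unfolding insert_eq using I(3) by (simp add: codim_def)
      moreover have "Y \<inter> \<Inter>(insert H I) = Y \<inter> \<Inter>(insert H S)"
        using I(2) by auto
      ultimately show ?thesis
        using I(1) by (intro exI[of _ "insert H I"]) blast
    qed
  qed
  then show ?thesis
    using that by blast
qed

text \<open>Consequently the independence condition of an arrangement matroid, stated as an
  inequality, is an equality.\<close>

lemma codim_le_card:
  assumes "vec.subspace Y" "S \<subseteq> A"
  shows "codim Y (Y \<inter> \<Inter>S) \<le> card S"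
  by (metis assms card_mono finite_A finite_subset obtain_codim_basis)

text \<open>A deficiency of \<open>I\<close> persists in \<open>J\<close>, since the hyperplanes of
  \<open>J - I\<close> lower the dimension by at most one each.\<close>

lemma independence_system: "finite_independence_system (arrangement_matroid Y A)"
  if Y: "vec.subspace Y"
proof
  show "indep (arrangement_matroid Y A) I" if "indep (arrangement_matroid Y A) J" "I \<subseteq> J" for I J
  proof -
    have J: "J \<subseteq> A" "card J \<le> codim Y (Y \<inter> \<Inter>J)"
      using that by (auto simp: arrangement_matroid_def)
    have sub: "vec.subspace (Y \<inter> \<Inter>I)"
      using that J Y subspace_flat[of I] by (auto intro: vec.subspace_inter)
    have eq: "Y \<inter> \<Inter>J = (Y \<inter> \<Inter>I) \<inter> \<Inter>(J - I)"
      using that by blast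
    have "codim (Y \<inter> \<Inter>I) (Y \<inter> \<Inter>J) \<le> card (J - I)"
      unfolding eq using sub J(1) by (intro codim_le_card) auto
    moreover have "vec.dim (Y \<inter> \<Inter>J) \<le> vec.dim (Y \<inter> \<Inter>I)" "vec.dim (Y \<inter> \<Inter>I) \<le> vec.dim Y"
      using that by (intro vec.dim_subset; blast)+
    moreover have "card (J - I) = card J - card I" "card I \<le> card J"
      using that J finite_A by (meson card_Diff_subset card_mono finite_subset)+
    ultimately have "card I \<le> codim Y (Y \<inter> \<Inter>I)"
      using J(2) unfolding codim_def by linarith
    then show ?thesis
      using that J by (simp add: arrangement_matroid_def)
  qed
qed (auto simp: arrangement_matroid_def finite_A)

text \<open>A codimension basis attains the value; an independent subset of \<open>S\<close> has no
  more elements than its own codimension, which that of \<open>S\<close> bounds.\<close>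

lemma matroid_rank_eq_codim:
  assumes Y: "vec.subspace Y" and S: "S \<subseteq> A"
  shows "matroid_rank (arrangement_matroid Y A) S = codim Y (Y \<inter> \<Inter>S)"
proof -
  interpret M: finite_independence_system "arrangement_matroid Y A"
    using Y by (rule independence_system)
  obtain I where I: "I \<subseteq> S" "Y \<inter> \<Inter>I = Y \<inter> \<Inter>S" "card I = codim Y (Y \<inter> \<Inter>S)"
    using obtain_codim_basis assms .
  then have "codim Y (Y \<inter> \<Inter>S) \<le> matroid_rank (arrangement_matroid Y A) S"
    using M.card_le_matroid_rank[of I S] S by (simp add: arrangement_matroid_def)
  moreover obtain J where J: "J \<subseteq> S" "indep (arrangement_matroid Y A) J"
      "card J = matroid_rank (arrangement_matroid Y A) S"
    using M.obtain_basis .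
  then have "card J \<le> codim Y (Y \<inter> \<Inter>J)"
    by (simp add: arrangement_matroid_def)
  moreover have "codim Y (Y \<inter> \<Inter>J) \<le> codim Y (Y \<inter> \<Inter>S)"
    using J by (intro codim_mono) blast
  ultimately show ?thesis
    using J(3) by linarith
qed

text \<open>
  If the flat \<open>X\<close> raises the rank of \<open>I\<close>, then so does one of the hyperplanes through \<open>X\<close>; hence each
  truncation lowers the bound on the rank of \<open>I \<union> F\<close> by one and changes nothing else.
\<close>

lemma iterated_principal_truncation_eq:
  fixes X
  defines "F \<equiv> flat_of A X"
  assumes X: "X \<in> intersection_lattice UNIV A" and "k < codim UNIV X"
  shows "(principal_truncation F ^^ k) (arrangement_matroid UNIV A) =
    Matroid A (\<lambda>I. I \<subseteq> A \<and> card I \<le> codim UNIV (\<Inter>I) \<and> card I + k \<le> codim UNIV (\<Inter>I \<inter> X))"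
  using \<open>k < codim UNIV X\<close>
proof (induction k)
  case 0
  \<comment> \<open>For \<open>k = 0\<close> the third conjunct follows from the second.\<close>
  have "codim UNIV (\<Inter>I) \<le> codim UNIV (\<Inter>I \<inter> X)" for I
    by (intro codim_mono) blast
  then show ?case
    by (simp add: arrangement_matroid_def fun_eq_iff not_less) (meson le_trans)
next
  case (Suc k)
  let ?M = "\<lambda>k. Matroid A (\<lambda>I. I \<subseteq> A \<and> card I \<le> codim UNIV (\<Inter>I) \<and>
    card I + k \<le> codim UNIV (\<Inter>I \<inter> X))"
  have F_sub: "F \<subseteq> A"
    by (auto simp: F_def flat_of_def)
  have Inter_F: "\<Inter>F = X"
    using X by (auto simp: F_def flat_of_def intersection_lattice_def)
  interpret M0: finite_independence_system "arrangement_matroid UNIV A"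
    by (rule independence_system) simp
  interpret M: finite_independence_system "?M k"
  proof
    show "indep (?M k) I" if "indep (?M k) J" "I \<subseteq> J" for I J
    proof -
      have J: "J \<subseteq> A" "card J \<le> codim UNIV (\<Inter>J)" "card J + k \<le> codim UNIV (\<Inter>J \<inter> X)"
        using that by auto
      have "card I \<le> codim UNIV (\<Inter>I)"
        using M0.indep_mono[of J I] J that by (auto simp: arrangement_matroid_def)
      moreover have sub: "vec.subspace (\<Inter>I \<inter> X)"
        using that J F_sub subspace_flat[of I] subspace_flat[of F] Inter_F
        by (auto intro: vec.subspace_inter)
      have eq: "\<Inter>J \<inter> X = (\<Inter>I \<inter> X) \<inter> \<Inter>(J - I)"
        using that by blast
      \<comment> \<open>The argument for arrangement matroids again, now inside \<Inter>I \<inter>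
        X; the summand \<open>k\<close> is carried along unchanged.\<close>
      have "codim (\<Inter>I \<inter> X) (\<Inter>J \<inter> X) \<le> card (J - I)"
        unfolding eq using sub J(1) by (intro codim_le_card) auto
      moreover have "vec.dim (\<Inter>J \<inter> X) \<le> vec.dim (\<Inter>I \<inter> X)"
          "vec.dim (\<Inter>I \<inter> X) \<le> vec.dim (UNIV :: (complex^'n) set)"
        using that by (intro vec.dim_subset; blast)+
      moreover have "card (J - I) = card J - card I" "card I \<le> card J"
        using that J finite_A by (meson card_Diff_subset card_mono finite_subset)+
      ultimately show ?thesis
        using that J unfolding codim_def by auto
    qed
  qed (use finite_A Suc.prems in auto)
  \<comment> \<open>An empty \<open>F\<close> would give X = UNIV, of codimension zero. A member of
    \<open>F\<close> is a nonloop of the current truncation because its trace on \<open>X\<close> is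
    all of \<open>X\<close>, of codimension above \<open>k\<close>.\<close>
  have "F \<noteq> {}"
    using Inter_F Suc.prems by (auto simp: codim_def)
  then obtain H where H: "H \<in> F"
    by blast
  have "indep (?M k) {H}"
  proof -
    have "H \<inter> X = X"
      using H by (auto simp: F_def flat_of_def)
    then show ?thesis
      using H F_sub Suc.prems hyperplane by auto
  qed
  then have "principal_truncation F (?M k) =
      Matroid A (\<lambda>I. indep (?M k) I \<and> (\<exists>x\<in>F - I. indep (?M k) (insert x I)))"
    using M.principal_truncation_eq[of F H] F_sub H by simp
  moreover have "indep (?M k) I \<and> (\<exists>x\<in>F - I. indep (?M k) (insert x I)) \<longleftrightarrow>
      indep (?M (Suc k)) I" for I
  proof
    assume *: "indep (?M k) I \<and> (\<exists>x\<in>F - I. indep (?M k) (insert x I))"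
    then obtain H where H: "H \<in> F" "H \<notin> I" "indep (?M k) (insert H I)"
      by blast
    \<comment> \<open>Adding \<open>H\<close> raises the cardinality by one and leaves the trace on
      \<open>X\<close> alone, which is why \<open>k\<close> becomes \<open>Suc k\<close>.\<close>
    then have "\<Inter>(insert H I) \<inter> X = \<Inter>I \<inter> X"
      by (auto simp: F_def flat_of_def)
    moreover have "finite I"
      using * finite_A finite_subset by auto
    ultimately show "indep (?M (Suc k)) I"
      using * H by auto
  next
    assume *: "indep (?M (Suc k)) I"
    then have I: "I \<subseteq> A" "card I \<le> codim UNIV (\<Inter>I)" "card I + Suc k \<le> codim UNIV (\<Inter>I \<inter> X)"
      by auto
    have fin: "finite I"
      using I finite_A finite_subset by auto
    \<comment> \<open>The codimension of \<Inter>I is exactly \<open>card I\<close>. Were \<Inter>I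
      contained in \<open>X\<close>, the third bound would read
      \<open>card I + Suc k \<le> card I\<close>.\<close>
    have "codim UNIV (\<Inter>I) \<le> card I"
      using codim_le_card[of UNIV I] I(1) by simp
    then have "\<not> \<Inter>I \<subseteq> X"
      using I(3) by (metis Int_absorb2 add_Suc_right add_leD1 le_antisym I(2) not_less_eq_eq Suc_leI le_add1 le_trans)
    then obtain H where H: "H \<in> F" "\<not> \<Inter>I \<subseteq> H"
      using Inter_F by blast
    then have "H \<notin> I" "vec.subspace H"
      using F_sub hyperplane by auto
    moreover have "\<Inter>(insert H I) \<inter> X = \<Inter>I \<inter> X"
      using H by (auto simp: F_def flat_of_def)
    moreover have "vec.dim (\<Inter>(insert H I)) < vec.dim (\<Inter>I)"
      using H F_sub I by (intro dim_less subspace_flat) auto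
    then have "codim UNIV (\<Inter>I) < codim UNIV (\<Inter>(insert H I))"
      using vec.dim_subset[of "\<Inter>I" UNIV] unfolding codim_def by auto
    ultimately have "H \<in> F - I" "indep (?M k) (insert H I)"
      using I H F_sub fin by auto
    then show "indep (?M k) I \<and> (\<exists>x\<in>F - I. indep (?M k) (insert x I))"
      using I by auto
  qed
  ultimately show ?case
    using Suc by (simp add: fun_eq_iff)
qed

end

section \<open>Generic points\<close>

text \<open>The complex bilinear pairing, without conjugation, so that for fixed \<open>a\<close> it
  is a polynomial in the coordinates of \<open>v\<close>.\<close>

definition linear_form :: "complex^'n \<Rightarrow> complex^'n \<Rightarrow> complex" where
  "linear_form a v = (\<Sum>i\<in>UNIV. a $ i * v $ i)"

lemma linear_form_add: "linear_form a (v + w) = linear_form a v + linear_form a w"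
  by (simp add: linear_form_def distrib_left sum.distrib)

lemma linear_form_scale: "linear_form a (c *s v) = c * linear_form a v"
  by (simp add: linear_form_def sum_distrib_left mult.left_commute)

lemma polynomial_sum:
  assumes "finite I" "\<And>i. i \<in> I \<Longrightarrow> complex_polynomial_function (p i)"
  shows "complex_polynomial_function (\<lambda>v. \<Sum>i\<in>I. p i v)"
  using assms
  by (induction I rule: finite_induct) (auto intro: complex_polynomial_function.intros)

lemma polynomial_prod:
  assumes "finite I" "\<And>i. i \<in> I \<Longrightarrow> complex_polynomial_function (p i)"
  shows "complex_polynomial_function (\<lambda>v. \<Prod>i\<in>I. p i v)"
  using assms
  by (induction I rule: finite_induct) (auto intro: complex_polynomial_function.intros)

lemma polynomial_linear_form: "complex_polynomial_function (linear_form a)"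
  unfolding linear_form_def
  by (intro polynomial_sum complex_polynomial_function.intros) simp

text \<open>A basis of \<open>W\<close> together with a vector \<open>u\<close> outside
  \<open>W\<close> is independent, so some linear map kills \<open>W\<close> but not
  \<open>u\<close>. A row of its matrix supplies the coefficients.\<close>

lemma obtain_linear_form:
  fixes W :: "(complex^'n) set"
  assumes W: "vec.subspace W" "W \<noteq> UNIV"
  obtains a u where "\<And>w. w \<in> W \<Longrightarrow> linear_form a w = 0" "linear_form a u \<noteq> 0"
proof -
  obtain u where u: "u \<notin> W"
    using W(2) by blast
  obtain B where B: "B \<subseteq> W" "vec.independent B" "W \<subseteq> vec.span B"
    using vec.basis_exists by metis
  then have "u \<notin> vec.span B"
    using u W(1) vec.span_minimal by blast
  then have "vec.independent (insert u B)" "u \<notin> B"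
    using B vec.span_base by (auto simp: vec.independent_insert)
  \<comment> \<open>Any coordinate serves: \<open>u\<close> is sent to the \<open>i\<close>-th axis
    vector and row \<open>i\<close> is read off.\<close>
  fix i :: 'n
  obtain g :: "complex^'n \<Rightarrow> complex^'n" where g: "Vector_Spaces.linear (*s) (*s) g"
      "\<forall>x\<in>insert u B. g x = (if x = u then axis i 1 else 0)"
    using vec.linear_independent_extend[OF \<open>vec.independent (insert u B)\<close>,
        of "\<lambda>x. if x = u then axis i 1 else 0"] by blast
  have lf: "linear_form (row i (matrix g)) v = g v $ i" for v
    using matrix_works[OF g(1), of v]
    by (simp add: linear_form_def row_def vec_eq_iff matrix_vector_mult_def)
  have "g w = 0" if "w \<in> W" for w
  proof -
    have "g x = 0" if "x \<in> B" for x
      using g(2) that \<open>u \<notin> B\<close> by auto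
    then show ?thesis
      using vec.linear_eq_0_on_span[OF g(1)] B(3) that by blast
  qed
  moreover have "g u $ i = 1"
    using g(2) by simp
  ultimately show ?thesis
    using that[of "row i (matrix g)" u] lf by simp
qed

text \<open>Start from a point good for \<open>N\<close> and move along a direction on which
  \<open>b\<close> is nonzero. On this line each form vanishes for at most one parameter, and the
  field is infinite.\<close>

lemma obtain_nonzero_linear_forms:
  assumes "finite N" "\<And>a. a \<in> N \<Longrightarrow> \<exists>u. linear_form a u \<noteq> 0"
  shows "\<exists>v. \<forall>a\<in>N. linear_form a v \<noteq> 0"
  using assms
proof (induction N rule: finite_induct)
  case (insert b N)
  then obtain v where v: "\<forall>a\<in>N. linear_form a v \<noteq> 0"
    by auto
  obtain u where u: "linear_form b u \<noteq> 0"
    using insert.prems by auto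
  have "finite (\<Union>a\<in>insert b N. {t. linear_form a (v + t *s u) = 0})"
  proof (intro finite_UN_I)
    fix a assume "a \<in> insert b N"
    then have "linear_form a u \<noteq> 0 \<or> linear_form a v \<noteq> 0"
      using u v by auto
    \<comment> \<open>If the slope is zero, the left side is empty and the default value of the
      quotient is harmless.\<close>
    then have "{t. linear_form a (v + t *s u) = 0} \<subseteq> {- linear_form a v / linear_form a u}"
      by (cases "linear_form a u = 0")
        (auto simp: linear_form_add linear_form_scale eq_neg_iff_add_eq_0 add_divide_eq_iff
          add.commute)
    then show "finite {t. linear_form a (v + t *s u) = 0}"
      using finite_subset by blast
  qed (use insert in simp)
  then obtain t where "t \<notin> (\<Union>a\<in>insert b N. {t. linear_form a (v + t *s u) = 0})"
    using ex_new_if_finite infinite_UNIV_char_0 by blast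
  then show ?case
    by blast
qed simp

text \<open>Each \<open>W\<close> is enlarged to the kernel of a nonzero form. The points outside
  all these kernels form the complement of the zero set of one polynomial, and this set is a union
  of cosets of \<open>X\<close> because every kernel contains \<open>X\<close>.\<close>

lemma for_generic_fiberI:
  fixes X :: "(complex^'n) set"
  assumes X: "vec.subspace X" and \<W>: "finite \<W>"
    and sub: "\<And>W. W \<in> \<W> \<Longrightarrow> vec.subspace W \<and> X \<subseteq> W \<and> W \<noteq> UNIV"
    and \<Phi>: "\<And>v. v \<notin> \<Union>\<W> \<Longrightarrow> \<Phi> (quotient_map X v)"
  shows "for_generic_fiber X \<Phi>"
proof -
  have "\<exists>a. (\<forall>w\<in>W. linear_form a w = 0) \<and> (\<exists>u. linear_form a u \<noteq> 0)" if "W \<in> \<W>" for W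
    using obtain_linear_form[of W] sub[OF that] by metis
  then obtain a where a: "\<And>W w. W \<in> \<W> \<Longrightarrow> w \<in> W \<Longrightarrow> linear_form (a W) w = 0"
      "\<And>W. W \<in> \<W> \<Longrightarrow> \<exists>u. linear_form (a W) u \<noteq> 0"
    by metis
  define G where "G = {v. \<forall>W\<in>\<W>. linear_form (a W) v \<noteq> 0}"
  define U where "U = quotient_map X ` G"
  have in_fiber: "v \<in> quotient_map X v" for v
    using vec.subspace_0[OF X] by (auto simp: quotient_map_def image_iff intro!: bexI[of _ 0])
  have fiber_eq: "quotient_map X w = quotient_map X v \<longleftrightarrow> w \<in> quotient_map X v" for v w
  proof
    assume "w \<in> quotient_map X v"
    then obtain x where x: "x \<in> X" "w = v + x"
      by (auto simp: quotient_map_def)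
    have "v + x + y \<in> (+) v ` X" "v + y \<in> (+) (v + x) ` X" if "y \<in> X" for y
      using X x(1) that
      by (auto simp: image_iff vec.subspace_def add.assoc intro: vec.subspace_diff
          intro!: bexI[of _ "x + y"] bexI[of _ "y - x"])
    then show "quotient_map X w = quotient_map X v"
      unfolding quotient_map_def x(2) by blast
  qed (use in_fiber in auto)
  have G_sat: "v + x \<in> G \<longleftrightarrow> v \<in> G" if "x \<in> X" for v x
    using a(1) sub that unfolding G_def by (auto simp: linear_form_add subset_iff)
  have preimage: "quotient_map X -` U = G"
  proof
    show "quotient_map X -` U \<subseteq> G"
    proof
      fix w assume "w \<in> quotient_map X -` U"
      then obtain v where "v \<in> G" "w \<in> quotient_map X v"
        by (auto simp: U_def fiber_eq)
      then show "w \<in> G"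
        using G_sat by (auto simp: quotient_map_def)
    qed
  qed (auto simp: U_def)
  show ?thesis
    unfolding for_generic_fiber_def
  proof (intro exI[of _ U] conjI ballI)
    show "U \<subseteq> range (quotient_map X)"
      by (auto simp: U_def)
    have "\<exists>v. \<forall>b\<in>a ` \<W>. linear_form b v \<noteq> 0"
      using \<W> a(2) by (intro obtain_nonzero_linear_forms) auto
    then show "U \<noteq> {}"
      by (auto simp: U_def G_def)
    \<comment> \<open>The product of the forms is the defining polynomial; for empty
      \<open>\<W>\<close> it is the constant 1 and \<open>G\<close> is everything.\<close>
    have "- G = {v. (\<Prod>W\<in>\<W>. linear_form (a W) v) = 0}"
      using \<W> by (auto simp: G_def)
    then show "zariski_open (quotient_map X -` U)"
      unfolding zariski_open_def preimage
      using polynomial_prod[OF \<W> polynomial_linear_form, of a]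
      by (intro exI[of _ "{\<lambda>v. \<Prod>W\<in>\<W>. linear_form (a W) v}"]) auto
    fix p assume "p \<in> U"
    then obtain v where v: "v \<in> G" "p = quotient_map X v"
      by (auto simp: U_def)
    then have "quotient_map X -` {p} = quotient_map X v"
      using fiber_eq by auto
    moreover have "v \<notin> \<Union>\<W>"
      using v(1) a(1) by (auto simp: G_def)
    ultimately show "\<Phi> (quotient_map X -` {p})"
      using \<Phi> by simp
  qed
qed

section \<open>The cone over a generic fiber\<close>

definition forget_height :: "complex^('n option) \<Rightarrow> complex^'n" where
  "forget_height w = (\<chi> j. w $ Some j)"

lemma forget_height_at_height [simp]: "forget_height (at_height t u) = u"
  by (simp add: forget_height_def at_height_def)

lemma linear_forget_height: "Vector_Spaces.linear (*s) (*s) forget_height"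
  by unfold_locales (simp_all add: forget_height_def vec_eq_iff algebra_simps)

lemma forget_height_image_span:
  "forget_height ` vec.span (at_height t ` K) = vec.span K"
  by (simp add: vec.linear_span_image[OF linear_forget_height, symmetric] image_image)

lemma subspace_scale_mem_iff:
  fixes W :: "(complex^'n) set"
  assumes "vec.subspace W"
  shows "c *s w \<in> W \<longleftrightarrow> c = 0 \<or> w \<in> W"
proof
  assume *: "c *s w \<in> W"
  show "c = 0 \<or> w \<in> W"
    using vec.subspace_scale[OF assms *, of "inverse c"] by (cases "c = 0") simp_all
qed (use assms in \<open>auto simp: vec.subspace_0 vec.subspace_scale\<close>)

text \<open>The point \<open>v\<close> has to avoid finitely many proper subspaces, the sums of
  \<open>X\<close> with flats. Each contains \<open>X\<close>, so the condition depends only on the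
  fiber through \<open>v\<close>.\<close>

locale generic_fiber = hyperplanes +
  fixes X :: "(complex^'n) set" and v :: "complex^'n"
  assumes X_flat: "X \<in> intersection_lattice UNIV A" and X_proper: "X \<noteq> UNIV"
    and generic: "I \<subseteq> A \<Longrightarrow> vec.span (\<Inter>I \<union> X) \<noteq> UNIV \<Longrightarrow> v \<notin> vec.span (\<Inter>I \<union> X)"
begin

section \<open>Sections by the span of the fiber and their ranks\<close>

definition Y :: "(complex^'n) set" where "Y = vec.span (insert v X)"

definition S :: "(complex^'n) set" where "S = quotient_map X v"

lemma X_eq_Inter_flat: "X = \<Inter>(flat_of A X)"
  using X_flat by (auto simp: flat_of_def intersection_lattice_def)

lemma flat_subset: "flat_of A X \<subseteq> A"
  by (auto simp: flat_of_def)

lemma subspace_X: "vec.subspace X"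
  using X_eq_Inter_flat flat_subset subspace_flat by metis

lemma span_X [simp]: "vec.span X = X"
  using subspace_X by (simp add: vec.span_eq_iff[THEN iffD2])

text \<open>The genericity condition for the flat of all hyperplanes through \<open>X\<close>, whose
  sum with \<open>X\<close> is \<open>X\<close>.\<close>

lemma v_notin_X: "v \<notin> X"
  using generic[OF flat_subset] X_proper by (simp flip: X_eq_Inter_flat)

lemma v_notin_hyperplane:
  assumes "H \<in> A" "X \<subseteq> H"
  shows "v \<notin> H"
proof -
  have "vec.span (H \<union> X) = H"
    using assms hyperplane(1) by (simp add: Un_absorb2 vec.span_eq_iff[THEN iffD2])
  moreover have "H \<noteq> UNIV"
    using hyperplane(2)[OF assms(1)] by (auto simp: codim_def)
  ultimately show ?thesis
    using generic[of "{H}"] assms(1) by simp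
qed

lemma subspace_Y: "vec.subspace Y"
  by (simp add: Y_def)

lemma mem_Y_iff: "w \<in> Y \<longleftrightarrow> (\<exists>t. w - t *s v \<in> X)"
  by (simp add: Y_def vec.span_insert)

lemma X_subset_Y: "X \<subseteq> Y"
  by (auto simp: Y_def intro: vec.span_base)

lemma dim_Y: "vec.dim Y = Suc (vec.dim X)"
  using v_notin_X by (simp add: Y_def vec.dim_insert)

text \<open>Write \<open>Z\<close> for \<Inter>I. By the dimension formula the left side is dim (Z +
  Y) - dim Z, and the second entry of the minimum is dim (Z + X) + 1 - dim Z. Moreover Z + Y is
  spanned by Z + X and \<open>v\<close>.\<close>

lemma codim_Int_Y:
  assumes I: "I \<subseteq> A"
  shows "codim Y (Y \<inter> \<Inter>I) =
    min (codim UNIV (\<Inter>I)) (codim UNIV (\<Inter>I \<inter> X) - (codim UNIV X - 1))"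
proof -
  let ?n = "vec.dim (UNIV :: (complex^'n) set)" and ?Z = "\<Inter>I"
  have Z: "vec.subspace ?Z"
    using I by (rule subspace_flat)
  have sums: "vec.span (?Z \<union> Y) = vec.span (insert v (?Z \<union> X))"
  proof
    have "Y \<subseteq> vec.span (insert v (?Z \<union> X))"
      unfolding Y_def by (intro vec.span_mono) auto
    then show "vec.span (?Z \<union> Y) \<subseteq> vec.span (insert v (?Z \<union> X))"
      using vec.span_superset[of "insert v (?Z \<union> X)"] by (intro vec.span_minimal) auto
    show "vec.span (insert v (?Z \<union> X)) \<subseteq> vec.span (?Z \<union> Y)"
      using vec.span_superset[of "insert v X"] by (intro vec.span_mono) (auto simp: Y_def)
  qed
  have dim_sum: "vec.dim (vec.span (?Z \<union> X)) + vec.dim (?Z \<inter> X) = vec.dim ?Z + vec.dim X"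
    using Z subspace_X by (rule dim_span_Un_Int)
  have dim_sum_Y: "vec.dim (vec.span (?Z \<union> Y)) + vec.dim (?Z \<inter> Y) = vec.dim ?Z + Suc (vec.dim X)"
    using dim_span_Un_Int[OF Z subspace_Y] dim_Y by simp
  have le: "vec.dim ?Z \<le> ?n" "vec.dim (?Z \<inter> X) \<le> vec.dim X" "vec.dim (?Z \<inter> X) \<le> vec.dim ?Z"
    by (intro vec.dim_subset; blast)+
  have X_less: "vec.dim X < ?n"
    using subspace_X X_proper by (intro dim_less) auto
  show ?thesis
  proof (cases "vec.span (?Z \<union> X) = UNIV")
    case True
    \<comment> \<open>The minimum is its first entry here; the second is larger by one.\<close>
    then have "vec.span (?Z \<union> Y) = UNIV"
      unfolding sums using vec.span_mono[of "?Z \<union> X" "insert v (?Z \<union> X)"] by auto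
    then show ?thesis
      using dim_sum dim_sum_Y le X_less True dim_Y
      unfolding codim_def Int_commute[of Y] by simp
  next
    case False
    then have v: "v \<notin> vec.span (?Z \<union> X)"
      using generic I by blast
    \<comment> \<open>Since \<open>v\<close> adds one dimension to the proper subspace Z + X, the
      minimum is its second entry.\<close>
    then have "vec.dim (vec.span (?Z \<union> Y)) = Suc (vec.dim (vec.span (?Z \<union> X)))"
      unfolding sums by (simp add: vec.dim_insert)
    moreover have "vec.dim (vec.span (?Z \<union> X)) < ?n"
      using False by (intro dim_less) auto
    ultimately show ?thesis
      using dim_sum dim_sum_Y le X_less dim_Y
      unfolding codim_def Int_commute[of Y] by simp
  qed
qed

lemma codim_X_pos: "0 < codim UNIV X"
proof -
  have "vec.dim X < vec.dim (UNIV :: (complex^'n) set)"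
    using subspace_X X_proper by (intro dim_less) auto
  then show ?thesis
    unfolding codim_def by (rule zero_less_diff[THEN iffD2])
qed

text \<open>After \<open>codim UNIV X - 1\<close> truncations the two bounds on
  \<open>card I\<close> say that it is at most the minimum in \<open>codim_Int_Y\<close>.\<close>

lemma complete_principal_truncation_eq:
  "complete_principal_truncation (flat_of A X) (arrangement_matroid UNIV A) = arrangement_matroid Y A"
proof -
  have "matroid_rank (arrangement_matroid UNIV A) (flat_of A X) = codim UNIV X"
    using matroid_rank_eq_codim[of UNIV "flat_of A X"] flat_subset X_eq_Inter_flat by simp
  moreover have "card I \<le> codim UNIV (\<Inter>I) \<and> card I + (codim UNIV X - 1) \<le> codim UNIV (\<Inter>I \<inter> X) \<longleftrightarrow>
      card I \<le> codim Y (Y \<inter> \<Inter>I)" if "I \<subseteq> A" for I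
  proof -
    \<comment> \<open>This guards the truncated subtraction: moving \<open>codim UNIV X - 1\<close>
      across the inequality must also be correct when \<open>I\<close> is empty.\<close>
    have "codim UNIV X \<le> codim UNIV (\<Inter>I \<inter> X)"
      by (rule codim_mono) blast
    then show ?thesis
      unfolding codim_Int_Y[OF that] by auto
  qed
  ultimately show ?thesis
    using iterated_principal_truncation_eq[OF X_flat, of "codim UNIV X - 1"] codim_X_pos
    unfolding complete_principal_truncation_def arrangement_matroid_def[of Y]
    by (auto simp: not_less fun_eq_iff)
qed

text \<open>The second entry of the minimum is at least one, so no hyperplane turns into a loop in
  \<open>Y\<close>.\<close>

lemma codim_hyperplane_Y:
  assumes H: "H \<in> A"
  shows "codim Y (Y \<inter> H) = 1"
proof -
  have "codim UNIV X \<le> codim UNIV (H \<inter> X)"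
    by (rule codim_mono) blast
  then show ?thesis
    using codim_Int_Y[of "{H}"] H hyperplane(2) codim_X_pos by simp
qed

text \<open>Two sections are hyperplanes of \<open>Y\<close>; their intersection still has
  codimension one only if they coincide.\<close>

lemma parallel_class_eq:
  assumes H: "H \<in> A"
  shows "parallel_class (arrangement_matroid Y A) H = {K \<in> A. Y \<inter> K = Y \<inter> H}"
proof -
  have "codim Y (Y \<inter> (H \<inter> K)) = 1 \<longleftrightarrow> Y \<inter> K = Y \<inter> H" if K: "K \<in> A" for K
  proof
    assume *: "codim Y (Y \<inter> (H \<inter> K)) = 1"
    have sub: "vec.subspace (Y \<inter> (H \<inter> K))" "vec.subspace (Y \<inter> H)" "vec.subspace (Y \<inter> K)"
      using H K hyperplane(1) subspace_Y by (auto intro!: vec.subspace_inter)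
    have "vec.dim (Y \<inter> H) \<le> vec.dim (Y \<inter> (H \<inter> K))" "vec.dim (Y \<inter> K) \<le> vec.dim (Y \<inter> (H \<inter> K))"
      using * codim_hyperplane_Y[OF H] codim_hyperplane_Y[OF K] unfolding codim_def by linarith+
    with sub have "Y \<inter> (H \<inter> K) = Y \<inter> H" "Y \<inter> (H \<inter> K) = Y \<inter> K"
      by (intro vec.subspace_dim_equal; blast)+
    then show "Y \<inter> K = Y \<inter> H"
      by simp
  next
    assume "Y \<inter> K = Y \<inter> H"
    then have "Y \<inter> (H \<inter> K) = Y \<inter> H"
      by blast
    then show "codim Y (Y \<inter> (H \<inter> K)) = 1"
      using codim_hyperplane_Y[OF H] by simp
  qed
  moreover have "matroid_rank (arrangement_matroid Y A) {H, K} = codim Y (Y \<inter> (H \<inter> K))"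
    if "K \<in> A" for K
    using matroid_rank_eq_codim[OF subspace_Y, of "{H, K}"] H that by simp
  moreover have "indep (arrangement_matroid Y A) {K}" if "K \<in> A" for K
    using that codim_hyperplane_Y by (simp add: arrangement_matroid_def)
  ultimately show ?thesis
    by (auto simp: parallel_class_def) (auto simp: arrangement_matroid_def)
qed

section \<open>The isomorphism from the cone space to the span of the fiber\<close>

lemma forget_height_cone_space: "forget_height ` cone_space S = Y"
proof -
  have "vec.span S = Y"
  proof
    have "S \<subseteq> Y"
      by (auto simp: S_def quotient_map_def mem_Y_iff intro!: exI[of _ 1])
    then show "vec.span S \<subseteq> Y"
      using subspace_Y by (rule vec.span_minimal)
    have v: "v \<in> S" and vx: "v + x \<in> S" if "x \<in> X" for x
      using that vec.subspace_0[OF subspace_X]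
      by (auto simp: S_def quotient_map_def image_iff intro!: bexI[of _ 0])
    have "x \<in> vec.span S" if "x \<in> X" for x
      using vec.span_diff[OF vec.span_base[OF vx[OF that]] vec.span_base[OF v[OF that]]] by simp
    then show "Y \<subseteq> vec.span S"
      unfolding Y_def using v vec.subspace_0[OF subspace_X]
      by (intro vec.span_minimal) (auto intro: vec.span_base)
  qed
  then show ?thesis
    by (simp add: cone_space_def forget_height_image_span)
qed

text \<open>On the cone space the height can be recovered: forgetting it gives the height times
  \<open>v\<close>, modulo \<open>X\<close>. A kernel element thus has a multiple of
  \<open>v\<close> in \<open>X\<close>, and its height is zero because \<open>v\<close> is not in
  \<open>X\<close>.\<close>

lemma inj_on_forget_height: "inj_on forget_height (cone_space S)"
proof -
  have "vec.subspace {w. forget_height w - w $ None *s v \<in> X}" (is "vec.subspace ?T")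
  proof -
    have add: "forget_height (w + z) - (w + z) $ None *s v =
        (forget_height w - w $ None *s v) + (forget_height z - z $ None *s v)"
      and scale: "forget_height (c *s w) - (c *s w) $ None *s v =
        c *s (forget_height w - w $ None *s v)"
      for w z :: "complex^('n option)" and c
      by (simp_all add: forget_height_def vec_eq_iff algebra_simps)
    have zero: "forget_height 0 - (0 :: complex^('n option)) $ None *s v = 0"
      by (simp add: forget_height_def vec_eq_iff)
    show ?thesis
      unfolding vec.subspace_def mem_Collect_eq add scale zero
      using subspace_X unfolding vec.subspace_def by blast
  qed
  moreover have "at_height 1 ` S \<subseteq> ?T"
    by (auto simp: S_def quotient_map_def) (simp add: at_height_def)
  ultimately have T: "cone_space S \<subseteq> ?T"
    unfolding cone_space_def by (intro vec.span_minimal)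
  have zero: "w = 0" if "w \<in> cone_space S" "forget_height w = 0" for w
  proof -
    have "forget_height w - w $ None *s v \<in> X"
      using T that(1) by blast
    then have "- (w $ None *s v) \<in> X"
      using that(2) by simp
    then have "w $ None *s v \<in> X"
      using vec.subspace_neg[OF subspace_X] by (metis minus_minus)
    then have "w $ None = 0"
      using v_notin_X subspace_X subspace_scale_mem_iff by blast
    moreover have "w $ Some j = 0" for j
      using that(2) by (simp add: forget_height_def vec_eq_iff)
    ultimately show ?thesis
      by (simp add: vec_eq_iff) (metis option.exhaust)
  qed
  show ?thesis
  proof (rule inj_onI)
    fix w z assume *: "w \<in> cone_space S" "z \<in> cone_space S" "forget_height w = forget_height z"
    then have "w - z \<in> cone_space S"
      by (simp add: cone_space_def vec.span_diff)
    moreover have "forget_height (w - z) = 0"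
      using *(3) by (simp add: forget_height_def vec_eq_iff)
    ultimately show "w = z"
      using zero by fastforce
  qed
qed

lemma dim_forget_height:
  assumes "Z \<subseteq> cone_space S"
  shows "vec.dim (forget_height ` Z) = vec.dim Z"
proof (rule vec.dim_image_eq[OF linear_forget_height])
  have "vec.span Z \<subseteq> cone_space S"
    using assms by (simp add: cone_space_def vec.span_minimal)
  then show "inj_on forget_height (vec.span Z)"
    using inj_on_forget_height inj_on_subset by blast
qed

section \<open>Members of the cone as sections of hyperplanes\<close>

abbreviation cone :: "(complex^('n option)) set set" where
  "cone \<equiv> arrangement_cone S (restriction A S)"

lemma direction_S: "direction S = X"
proof
  show "direction S \<subseteq> X"
    using vec.subspace_diff[OF subspace_X] by (auto simp: direction_def S_def quotient_map_def)
  have "x = (v + x) - (v + 0)" for x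
    by simp
  then show "X \<subseteq> direction S"
    using vec.subspace_0[OF subspace_X] unfolding direction_def S_def quotient_map_def by blast
qed

lemma cone_subset: "K \<in> cone \<Longrightarrow> K \<subseteq> cone_space S"
proof -
  \<comment> \<open>Points at infinity are differences of points of height one.\<close>
  have "at_height 0 (u - w) = at_height 1 u - at_height 1 w" for u w :: "complex^'n"
    by (auto simp: at_height_def vec_eq_iff split: option.split)
  then have "at_height 0 (u - w) \<in> cone_space S" if "u \<in> S" "w \<in> S" for u w
    unfolding cone_space_def using that by (metis imageI vec.span_base vec.span_diff)
  then have "at_height 0 ` direction S \<subseteq> cone_space S"
    by (auto simp: direction_def)
  moreover have "vec.span (at_height 1 ` L) \<subseteq> cone_space S" if "L \<subseteq> S" for L
    unfolding cone_space_def using that by (intro vec.span_mono) auto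
  ultimately show "K \<in> cone \<Longrightarrow> K \<subseteq> cone_space S"
    unfolding arrangement_cone_def restriction_def by blast
qed

text \<open>Modulo X \<subseteq> H a vector of \<open>Y\<close> is a multiple of \<open>v\<close>,
  and \<open>v\<close> is not in \<open>H\<close>. Hence all hyperplanes through \<open>X\<close>
  share one section, the one that matches infinity.\<close>

lemma hyperplane_Int_Y_through_X:
  assumes "H \<in> A" "X \<subseteq> H"
  shows "Y \<inter> H = X"
proof
  show "Y \<inter> H \<subseteq> X"
  proof
    fix w assume w: "w \<in> Y \<inter> H"
    then obtain t where t: "w - t *s v \<in> X"
      by (auto simp: mem_Y_iff)
    have "w - (w - t *s v) \<in> H"
      using w t assms hyperplane(1) by (metis IntD2 subsetD vec.subspace_diff)
    then have "t *s v \<in> H"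
      by simp
    then have "t = 0"
      using v_notin_hyperplane[OF assms] hyperplane(1)[OF assms(1)] subspace_scale_mem_iff by blast
    then show "w \<in> X"
      using t by simp
  qed
qed (use X_subset_Y assms in blast)

lemma S_disjoint_hyperplane_through_X:
  assumes "H \<in> A" "X \<subseteq> H"
  shows "H \<inter> S = {}"
proof -
  have "v \<in> H" if "v + x \<in> H" "x \<in> X" for x
    using vec.subspace_diff[OF hyperplane(1)[OF assms(1)] that(1), of x] that assms by auto
  then show ?thesis
    using v_notin_hyperplane[OF assms] by (auto simp: S_def quotient_map_def)
qed

text \<open>A hyperplane not containing \<open>X\<close> spans everything together with
  \<open>X\<close>, so \<open>v\<close> can be moved into it along \<open>X\<close>.\<close>

lemma S_meets_hyperplane:
  assumes "H \<in> A" "\<not> X \<subseteq> H"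
  obtains x where "x \<in> X" "v + x \<in> H"
proof -
  have "vec.span (H \<union> X) \<noteq> H"
    using assms(2) vec.span_superset[of "H \<union> X"] by blast
  then have "vec.span (H \<union> X) = UNIV"
    using subset_hyperplaneD[OF hyperplane[OF assms(1)], of "vec.span (H \<union> X)"]
      vec.span_superset[of "H \<union> X"] by blast
  then have "v \<in> {x + y |x y. x \<in> H \<and> y \<in> X}"
    using sums_eq_span_Un[OF hyperplane(1)[OF assms(1)] subspace_X] by simp
  then obtain h y where h: "v = h + y" "h \<in> H" "y \<in> X"
    by blast
  then have "v + (- y) \<in> H" "- y \<in> X"
    using vec.subspace_neg[OF subspace_X] by auto
  then show ?thesis
    using that by blast
qed

text \<open>Fix a point \<open>v + x\<close> of H \<inter> S. Subtracting a suitable multiple of it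
  from a vector of Y \<inter> H leaves a vector of X \<inter> H, which is a difference of two points
  of H \<inter> S.\<close>

lemma span_hyperplane_Int_S:
  assumes "H \<in> A" "\<not> X \<subseteq> H"
  shows "vec.span (H \<inter> S) = Y \<inter> H"
proof
  have H: "vec.subspace H"
    using assms hyperplane(1) by simp
  have "H \<inter> S \<subseteq> Y \<inter> H"
    by (auto simp: S_def quotient_map_def mem_Y_iff intro!: exI[of _ 1])
  then show "vec.span (H \<inter> S) \<subseteq> Y \<inter> H"
    using H subspace_Y by (intro vec.span_minimal vec.subspace_inter)
  obtain x where x: "x \<in> X" "v + x \<in> H"
    using S_meets_hyperplane[OF assms] .
  have mem: "v + z \<in> vec.span (H \<inter> S)" if "v + z \<in> H" "z \<in> X" for z
    using that by (intro vec.span_base) (auto simp: S_def quotient_map_def)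
  show "Y \<inter> H \<subseteq> vec.span (H \<inter> S)"
  proof
    fix w assume w: "w \<in> Y \<inter> H"
    then obtain t where t: "w - t *s v \<in> X"
      by (auto simp: mem_Y_iff)
    have "w - t *s (v + x) \<in> H"
      using w x H by (intro vec.subspace_diff vec.subspace_scale) auto
    then have "(v + x) + (w - t *s (v + x)) \<in> H"
      by (rule vec.subspace_add[OF H x(2)])
    \<comment> \<open>Chosen so that \<open>v + z\<close> is \<open>v + x\<close> shifted by that
      difference; this arrangement of the terms shows \<open>z\<close> in \<open>X\<close>.\<close>
    moreover define z where "z = x + ((w - t *s v) - t *s x)"
    have z: "v + z = (v + x) + (w - t *s (v + x))"
      by (simp add: z_def vec_eq_iff algebra_simps)
    moreover have "z \<in> X"
      unfolding z_def
      by (rule vec.subspace_add[OF subspace_X x(1)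
            vec.subspace_diff[OF subspace_X t vec.subspace_scale[OF subspace_X x(1)]]])
    ultimately have "v + z \<in> vec.span (H \<inter> S)"
      by (metis mem)
    moreover have "v + x \<in> vec.span (H \<inter> S)"
      using x mem by blast
    moreover have "w = ((v + z) - (v + x)) + t *s (v + x)"
      by (simp add: z)
    ultimately show "w \<in> vec.span (H \<inter> S)"
      by (metis vec.span_add vec.span_diff vec.span_scale)
  qed
qed

lemma forget_height_cone: "(`) forget_height ` cone = (\<lambda>H. Y \<inter> H) ` A"
proof
  have infinity: "forget_height ` at_height 0 ` direction S = X"
    by (simp add: direction_S image_image)
  \<comment> \<open>Some hyperplane contains the proper flat \<open>X\<close>; without it infinity
    would have no counterpart among the sections.\<close>
  have "flat_of A X \<noteq> {}"
    using X_eq_Inter_flat X_proper by auto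
  then obtain H0 where H0: "H0 \<in> A" "X \<subseteq> H0"
    by (auto simp: flat_of_def)
  show "(`) forget_height ` cone \<subseteq> (\<lambda>H. Y \<inter> H) ` A"
  proof (rule image_subsetI)
    fix K assume "K \<in> cone"
    then have "K = at_height 0 ` direction S \<or>
        (\<exists>H\<in>A. H \<inter> S \<noteq> {} \<and> K = vec.span (at_height 1 ` (H \<inter> S)))"
      by (auto simp: arrangement_cone_def restriction_def)
    then consider "K = at_height 0 ` direction S"
      | H where "H \<in> A" "H \<inter> S \<noteq> {}" "K = vec.span (at_height 1 ` (H \<inter> S))"
      by blast
    then show "forget_height ` K \<in> (\<lambda>H. Y \<inter> H) ` A"
    proof cases
      case 1
      then have "forget_height ` K = Y \<inter> H0"
        using infinity hyperplane_Int_Y_through_X[OF H0] by simp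
      then show ?thesis
        using H0(1) by (rule image_eqI)
    next
      case 2
      then have "\<not> X \<subseteq> H"
        using S_disjoint_hyperplane_through_X by blast
      then have "forget_height ` K = Y \<inter> H"
        using 2 by (simp add: forget_height_image_span span_hyperplane_Int_S)
      then show ?thesis
        using 2(1) by (rule image_eqI)
    qed
  qed
  show "(\<lambda>H. Y \<inter> H) ` A \<subseteq> (`) forget_height ` cone"
  proof (rule image_subsetI)
    fix H assume H: "H \<in> A"
    show "Y \<inter> H \<in> (`) forget_height ` cone"
    proof (cases "X \<subseteq> H")
      case True
      then show ?thesis
        using infinity hyperplane_Int_Y_through_X[OF H] by (auto simp: arrangement_cone_def)
    next
      case False
      obtain x where "x \<in> X" "v + x \<in> H"
        using S_meets_hyperplane[OF H False] .
      then have "H \<inter> S \<noteq> {}"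
        by (auto simp: S_def quotient_map_def)
      moreover have "H \<inter> S \<noteq> S"
      proof
        assume "H \<inter> S = S"
        then have "direction S \<subseteq> H"
          using vec.subspace_diff[OF hyperplane(1)[OF H]] by (auto simp: direction_def)
        then show False
          using False direction_S by simp
      qed
      ultimately have "H \<inter> S \<in> restriction A S"
        using H by (auto simp: restriction_def)
      then have "vec.span (at_height 1 ` (H \<inter> S)) \<in> cone"
        by (simp add: arrangement_cone_def)
      moreover have "Y \<inter> H = forget_height ` vec.span (at_height 1 ` (H \<inter> S))"
        using span_hyperplane_Int_S[OF H False] by (simp add: forget_height_image_span)
      ultimately show ?thesis
        by (rule rev_image_eqI)
    qed
  qed
qed

text \<open>An injective linear map commutes with intersections of subsets of its domain and
  preserves dimension.\<close>

lemma codim_cone: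
  assumes B: "B \<subseteq> cone"
  shows "codim (cone_space S) (cone_space S \<inter> \<Inter>B) = codim Y (Y \<inter> \<Inter>((`) forget_height ` B))"
proof -
  have "forget_height ` (cone_space S \<inter> \<Inter>B) = Y \<inter> \<Inter>((`) forget_height ` B)"
  proof
    show "Y \<inter> \<Inter>((`) forget_height ` B) \<subseteq> forget_height ` (cone_space S \<inter> \<Inter>B)"
    proof
      fix y assume y: "y \<in> Y \<inter> \<Inter>((`) forget_height ` B)"
      then obtain w where w: "w \<in> cone_space S" "y = forget_height w"
        using forget_height_cone_space by blast
      have "w \<in> K" if K: "K \<in> B" for K
      proof -
        obtain z where z: "z \<in> K" "y = forget_height z"
          using y K by blast
        then have "z \<in> cone_space S"
          using K B cone_subset by blast
        then show ?thesis
          using z w inj_on_forget_height by (metis inj_onD)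
      qed
      then show "y \<in> forget_height ` (cone_space S \<inter> \<Inter>B)"
        using w by blast
    qed
  qed (use forget_height_cone_space in blast)
  then show ?thesis
    using dim_forget_height[of "cone_space S \<inter> \<Inter>B"] dim_forget_height[of "cone_space S"]
      forget_height_cone_space by (simp add: codim_def)
qed

text \<open>The bijection \<open>f\<close> sends a member of the cone to the parallel class of all
  hyperplanes with the corresponding section.\<close>

theorem cone_isomorphic:
  "matroid_isomorphic (arrangement_matroid (cone_space S) cone)
    (simplification (complete_principal_truncation (flat_of A X) (arrangement_matroid UNIV A)))"
proof -
  let ?T = "arrangement_matroid Y A"
  define cls where "cls L = {H \<in> A. Y \<inter> H = L}" for L
  define f where "f K = cls (forget_height ` K)" for K
  have nonloops: "{H \<in> ground ?T. indep ?T {H}} = A"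
    using codim_hyperplane_Y by (auto simp: arrangement_matroid_def)
  have "parallel_class ?T ` A = cls ` (\<lambda>H. Y \<inter> H) ` A"
    using parallel_class_eq by (auto simp: cls_def image_image)
  also have "\<dots> = f ` cone"
    unfolding forget_height_cone[symmetric] by (simp add: f_def image_image)
  finally have simp_eq: "simplification ?T =
      Matroid (f ` cone) (\<lambda>C. C \<subseteq> f ` cone \<and> matroid_rank ?T (\<Union>C) = card C)"
    unfolding simplification_def nonloops Let_def by simp
  have rep: "\<exists>H\<in>A. Y \<inter> H = forget_height ` K" if "K \<in> cone" for K
  proof -
    have "forget_height ` K \<in> (\<lambda>H. Y \<inter> H) ` A"
      unfolding forget_height_cone[symmetric] using that by (rule imageI)
    then show ?thesis
      by auto
  qed
  have inj: "inj_on f cone"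
  proof (rule inj_onI)
    fix K L assume *: "K \<in> cone" "L \<in> cone" "f K = f L"
    obtain H where "H \<in> A" "Y \<inter> H = forget_height ` K"
      using rep *(1) by blast
    then have "H \<in> f L"
      unfolding *(3)[symmetric] by (simp add: f_def cls_def)
    then have "forget_height ` K = forget_height ` L"
      using \<open>Y \<inter> H = forget_height ` K\<close> by (simp add: f_def cls_def)
    then show "K = L"
      using * cone_subset inj_on_forget_height by (metis inj_on_image_eq_iff)
  qed
  have "indep (arrangement_matroid (cone_space S) cone) B \<longleftrightarrow> indep (simplification ?T) (f ` B)"
    if B: "B \<subseteq> cone" for B
  proof -
    have Un: "\<Union>(f ` B) \<subseteq> A"
      by (auto simp: f_def cls_def)
    \<comment> \<open>One representative per class cuts out the same subspace of \<open>Y\<close> as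
      the whole classes do.\<close>
    obtain h where h: "h K \<in> A" "Y \<inter> h K = forget_height ` K" if "K \<in> B" for K
      using rep B by (metis subsetD)
    have eq: "Y \<inter> \<Inter>(h ` B) = Y \<inter> \<Inter>((`) forget_height ` B)"
      using h(2) by blast
    have "Y \<inter> \<Inter>(\<Union>(f ` B)) = Y \<inter> \<Inter>((`) forget_height ` B)"
    proof
      show "Y \<inter> \<Inter>(\<Union>(f ` B)) \<subseteq> Y \<inter> \<Inter>((`) forget_height ` B)"
        unfolding eq[symmetric] using h by (auto simp: f_def cls_def)
    qed (auto simp: f_def cls_def)
    then have rank: "matroid_rank ?T (\<Union>(f ` B)) = codim (cone_space S) (cone_space S \<inter> \<Inter>B)"
      using matroid_rank_eq_codim[OF subspace_Y Un] codim_cone[OF B] by simp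
    have "finite cone"
      using finite_A by (simp add: arrangement_cone_def restriction_def)
    then have fin: "finite B"
      using B finite_subset by blast
    \<comment> \<open>Representatives bound the codimension by \<open>card B\<close>. This
      reconciles the inequality defining independence in the cone with the equality in the
      simplification.\<close>
    have "codim Y (Y \<inter> \<Inter>(h ` B)) \<le> card (h ` B)"
      using h by (intro codim_le_card subspace_Y) auto
    then have "codim (cone_space S) (cone_space S \<inter> \<Inter>B) \<le> card B"
      using codim_cone[OF B] card_image_le[OF fin, of h] unfolding eq by linarith
    moreover have "card (f ` B) = card B"
      using inj B by (meson card_image inj_on_subset)
    ultimately show ?thesis
      using B unfolding simp_eq by (auto simp: rank) (auto simp: arrangement_matroid_def)
  qed
  moreover have "ground (arrangement_matroid (cone_space S) cone) = cone"
    by (simp add: arrangement_matroid_def)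
  ultimately show ?thesis
    unfolding complete_principal_truncation_eq matroid_isomorphic_def
    using inj by (intro exI[of _ f]) (auto simp: bij_betw_def simp_eq)
qed

end

section \<open>Passage to the generic fiber\<close>

theorem theorem2p1:
  fixes A :: "(complex^'n) set set" and X :: "(complex^'n) set"
  assumes "central_arrangement UNIV A"
    and "X \<in> intersection_lattice UNIV A"
    and "X \<noteq> UNIV"
  shows "for_generic_fiber X (\<lambda>S.
    matroid_isomorphic
      (arrangement_matroid (cone_space S) (arrangement_cone S (restriction A S)))
      (simplification
        (complete_principal_truncation (flat_of A X) (arrangement_matroid UNIV A))))"
proof -
  interpret hyperplanes A
    using assms(1) by unfold_locales (auto simp: central_arrangement_def)
  obtain B where "B \<subseteq> A" "X = \<Inter>B"
    using assms(2) by (auto simp: intersection_lattice_def)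
  then have X: "vec.subspace X"
    using subspace_flat by simp
  \<comment> \<open>The finitely many proper sums of a flat with \<open>X\<close>; avoiding them is
    the genericity condition of \<open>generic_fiber\<close>.\<close>
  define \<W> where "\<W> = (\<lambda>I. vec.span (\<Inter>I \<union> X)) ` Pow A - {UNIV}"
  show ?thesis
  proof (rule for_generic_fiberI[where \<W> = \<W>])
    show "finite \<W>"
      using finite_A by (simp add: \<W>_def)
    show "vec.subspace W \<and> X \<subseteq> W \<and> W \<noteq> UNIV" if W: "W \<in> \<W>" for W
    proof -
      obtain I where "W = vec.span (\<Inter>I \<union> X)" "W \<noteq> UNIV"
        using W unfolding \<W>_def by blast
      then show ?thesis
        using vec.span_superset[of "\<Inter>I \<union> X"] by simp
    qed
    fix v assume v: "v \<notin> \<Union>\<W>"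
    interpret generic_fiber A X v
      using assms v by unfold_locales (auto simp: \<W>_def)
    show "matroid_isomorphic
        (arrangement_matroid (cone_space (quotient_map X v))
          (arrangement_cone (quotient_map X v) (restriction A (quotient_map X v))))
        (simplification
          (complete_principal_truncation (flat_of A X) (arrangement_matroid UNIV A)))"
      using cone_isomorphic unfolding S_def .
  qed (rule X)
qed

end
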